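(* Let $f:(X,\mathcal{O}_X)\to(Y,\mathcal{O}_Y)$ and $g:(Y,\mathcal{O}_Y)\to(Z,\mathcal{O}_Z)$ be continuous mappings between topological spaces which have compact continuations $$\widehat f:(\widehat X,\mathcal{O}_{\widehat X})\to(\widehat Y,\mathcal{O}_{\widehat Y}),\qquad \tilde g:(\tilde Y,\mathcal{O}_{\tilde Y})\to(\tilde Z,\mathcal{O}_{\tilde Z}),$$ respectively. Then $h:=g\circ f$ has a compact continuation $\widehat h:(\widehat X,\mathcal{O}_{\widehat X})\to(\tilde Z,\mathcal{O}_{\tilde Z})$ if one of the following conditions is fulfilled: (i) $\mathrm{id}_Y:(Y,\mathcal{O}_Y)\to(Y,\mathcal{O}_Y)$ has a compact continuation $\widehat{\mathrm{id}_Y}:(\widehat Y,\mathcal{O}_{\widehat Y})\to(\tilde Y,\mathcal{O}_{\tilde Y})$. (ii) $\mathrm{id}_Y$ has a compact continuation $\widetilde{\mathrm{id}_Y}:(\tilde Y,\mathcal{O}_{\tilde Y})\to(\widehat Y,\mathcal{O}_{\widehat Y})$ which is identifying and which fulfills, for all $y_1,y_2\in\tilde Y$: $\widetilde{\mathrm{id}_Y}(y_1)=\widetilde{\mathrm{id}_Y}(y_2)\implies\tilde g(y_1)=\tilde g(y_2)$. (iii) $\mathrm{id}_Y$ has a surjective compact continuation $\widetilde{\mathrm{id}_Y}:(\tilde Y,\mathcal{O}_{\tilde Y})\to(\widehat Y,\mathcal{O}_{\widehat Y})$, where $(\widehat Y,\mathcal{O}_{\widehat Y})$ is a Hausdorff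 space and, for all $y_1,y_2\in\tilde Y$: $\widetilde{\mathrm{id}_Y}(y_1)=\widetilde{\mathrm{id}_Y}(y_2)\implies\tilde g(y_1)=\tilde g(y_2)$. If, in addition to (i), respectively (ii) or (iii), both $\widehat f$ and $\widehat{\mathrm{id}_Y}$, respectively $\widetilde{\mathrm{id}_Y}$, are home leaving compact continuations, then $\widehat h$ can be chosen such that $\widehat h[\widehat X\setminus X]\subseteq\tilde g[\tilde Y\setminus Y]$.
   Context: For a continuous mapping $f:(V,\mathcal{O})\to(V',\mathcal{O}')$, a compact continuation of $f$ is a mapping $\widehat f:(\widehat V,\widehat{\mathcal{O}})\to(\widehat V',\widehat{\mathcal{O}}')$ such that: $(\widehat V,\widehat{\mathcal{O}})$ is a compact topological space (compact = every open cover has a finite subcover, no Hausdorff assumption) containing $(V,\mathcal{O})$ as a subspace; $(\widehat V',\widehat{\mathcal{O}}')$ is a topological space containing $(V',\mathcal{O}')$ as a subspace; $\widehat f$ is continuous and $\widehat f(v)=f(v)$ for all $v\in V$. It is called home leaving if additionally $\widehat f[\widehat V\setminus V]\subseteq\widehat V'\setminus V'$. A mapping $q:(X,\mathcal{O})\to(X',\mathcal{O}')$ is identifying (a quotient map) iff it is surjective and $\mathcal{O}'=\{O'\subseteq X': q^{-1}[O']\in\mathcal{O}\}$. *)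

theory Defs
  imports "HOL-Analysis.Analysis"
begin

text \<open>Compactness is \<^const>\<open>compact_space\<close>, which does not include the Hausdorff property.\<close>

definition contains_as_subspace :: "'a topology \<Rightarrow> 'a topology \<Rightarrow> bool" where
  "contains_as_subspace W V \<longleftrightarrow>
     topspace V \<subseteq> topspace W \<and> V = subtopology W (topspace V)"

text \<open>
  In \<open>compact_continuation V V' f W W' F\<close>, the map \<open>F\<close> from \<open>W\<close> to \<open>W'\<close> continues the
  map \<open>f\<close> from \<open>V\<close> to \<open>V'\<close>. Only the domain \<open>W\<close> has to be compact; \<open>V\<close> need not be
  dense in \<open>W\<close>.
\<close>

definition compact_continuation ::
  "'a topology \<Rightarrow> 'b topology \<Rightarrow> ('a \<Rightarrow> 'b) \<Rightarrow> 'a topology \<Rightarrow> 'b topology \<Rightarrow> ('a \<Rightarrow> 'b) \<Rightarrow> bool" where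
  "compact_continuation V V' f W W' F \<longleftrightarrow>
     continuous_map V V' f \<and>
     compact_space W \<and> contains_as_subspace W V \<and>
     contains_as_subspace W' V' \<and>
     continuous_map W W' F \<and> (\<forall>v \<in> topspace V. F v = f v)"

definition home_leaving_compact_continuation ::
  "'a topology \<Rightarrow> 'b topology \<Rightarrow> ('a \<Rightarrow> 'b) \<Rightarrow> 'a topology \<Rightarrow> 'b topology \<Rightarrow> ('a \<Rightarrow> 'b) \<Rightarrow> bool" where
  "home_leaving_compact_continuation V V' f W W' F \<longleftrightarrow>
     compact_continuation V V' f W W' F \<and>
     F ` (topspace W - topspace V) \<subseteq> topspace W' - topspace V'"

end

theory Submission
  imports Defs
begin

text \<open>
  In each case there is a continuous extension \<open>k\<close> of \<open>g\<close> from \<open>Yhat\<close> to \<open>Ztilde\<close>, and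
  \<open>k \<circ> fhat\<close> is the required continuation. Under (i), \<open>k\<close> is \<open>gtilde\<close> after the
  continuation of the identity; under (ii), it is the map that \<open>gtilde\<close> induces on the
  quotient \<open>Yhat\<close> of \<open>Ytilde\<close>. Condition (iii) is a case of (ii), since a continuous
  surjection from a compact space onto a Hausdorff space is a quotient map.
\<close>

text \<open>On \<open>X\<close>, \<open>fhat\<close> agrees with \<open>f\<close>, whose values lie
  in \<open>Y\<close>, where \<open>k\<close> agrees with \<open>g\<close>; so
  \<open>k \<circ> fhat\<close> extends \<open>g \<circ> f\<close>. Compactness of
  \<open>Xhat\<close> is inherited from the continuation of \<open>f\<close>. This reduces each case
  to finding \<open>k\<close>.\<close>

lemma compact_continuation_compose:
  assumes f: "compact_continuation X Y f Xhat Yhat fhat"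
    and g: "continuous_map Y Z g" "contains_as_subspace Ztilde Z"
    and k: "continuous_map Yhat Ztilde k" "\<And>y. y \<in> topspace Y \<Longrightarrow> k y = g y"
  shows "compact_continuation X Z (g \<circ> f) Xhat Ztilde (k \<circ> fhat)"
proof -
  have "f x \<in> topspace Y" if "x \<in> topspace X" for x
    using f that by (auto simp: compact_continuation_def dest: continuous_map_funspace)
  then show ?thesis
    using assms by (auto simp: compact_continuation_def intro: continuous_map_compose)
qed

lemma extension_along_id:
  assumes g: "compact_continuation Y Z g Ytilde Ztilde gtilde"
    and j: "compact_continuation Y Y id Yhat Ytilde j"
  shows "continuous_map Yhat Ztilde (gtilde \<circ> j)"
    and "\<And>y. y \<in> topspace Y \<Longrightarrow> (gtilde \<circ> j) y = g y"
  using assms by (auto simp: compact_continuation_def intro: continuous_map_compose)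

text \<open>This is the universal property of the quotient: \<open>gtilde\<close> is constant on the
  fibres of \<open>j\<close>, so it factors as \<open>k \<circ> j\<close> with \<open>k\<close>
  continuous. The factorization itself is exported along with \<open>k\<close> because the home
  leaving part has to trace values of \<open>k\<close> back to \<open>gtilde\<close>.\<close>

lemma extension_through_quotient:
  assumes g: "compact_continuation Y Z g Ytilde Ztilde gtilde"
    and j: "compact_continuation Y Y id Ytilde Yhat j"
    and q: "quotient_map Ytilde Yhat j"
    and fibres: "\<forall>y1 \<in> topspace Ytilde. \<forall>y2 \<in> topspace Ytilde. j y1 = j y2 \<longrightarrow> gtilde y1 = gtilde y2"
  obtains k where "continuous_map Yhat Ztilde k"
    and "\<And>y. y \<in> topspace Ytilde \<Longrightarrow> k (j y) = gtilde y"
    and "\<And>y. y \<in> topspace Y \<Longrightarrow> k y = g y"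
proof -
  have "continuous_map Ytilde Ztilde gtilde"
    using g by (simp add: compact_continuation_def)
  then obtain k where k: "continuous_map Yhat Ztilde k"
    "\<And>y. y \<in> topspace Ytilde \<Longrightarrow> k (j y) = gtilde y"
    using quotient_map_lift_exists[OF q] fibres by metis
  have "k y = g y" if y: "y \<in> topspace Y" for y
  proof -
    \<comment> \<open>A point of \<open>Y\<close> is its own preimage under \<open>j\<close>, so
      \<open>k y = k (j y) = gtilde y = g y\<close>.\<close>
    have "y \<in> topspace Ytilde" "j y = y" "gtilde y = g y"
      using g j y by (auto simp: compact_continuation_def contains_as_subspace_def)
    with k(2)[of y] show ?thesis by simp
  qed
  with k show thesis using that by blast
qed

text \<open>A continuous map from a compact space to a Hausdorff space is closed, and a closed
  continuous surjection is a quotient map.\<close>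

lemma quotient_map_onto_Hausdorff:
  assumes "compact_continuation V V' f W W' F"
    and "F ` topspace W = topspace W'" "Hausdorff_space W'"
  shows "quotient_map W W' F"
  using assms by (auto simp: compact_continuation_def intro: continuous_imp_quotient_map)

lemma compact_continuation_if_home_leaving:
  "home_leaving_compact_continuation V V' f W W' F \<Longrightarrow> compact_continuation V V' f W W' F"
  by (simp add: home_leaving_compact_continuation_def)

lemma extension_image_along_id:
  assumes "home_leaving_compact_continuation Y Y id Yhat Ytilde j"
  shows "(gtilde \<circ> j) ` (topspace Yhat - topspace Y) \<subseteq> gtilde ` (topspace Ytilde - topspace Y)"
  using assms by (auto simp: home_leaving_compact_continuation_def)

text \<open>A point outside \<open>Y\<close> lifts along \<open>j\<close> by surjectivity. The lift
  is outside \<open>Y\<close> too, since \<open>j\<close> fixes every point of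
  \<open>Y\<close>.\<close>

lemma extension_image_through_quotient:
  assumes j: "compact_continuation Y Y id Ytilde Yhat j"
    and surj: "j ` topspace Ytilde = topspace Yhat"
    and k: "\<And>y. y \<in> topspace Ytilde \<Longrightarrow> k (j y) = gtilde y"
  shows "k ` (topspace Yhat - topspace Y) \<subseteq> gtilde ` (topspace Ytilde - topspace Y)"
proof (rule image_subsetI)
  fix y assume y: "y \<in> topspace Yhat - topspace Y"
  then obtain y' where y': "y' \<in> topspace Ytilde" "y = j y'" using surj by blast
  have "y' \<notin> topspace Y"
    using j y y'(2) by (auto simp: compact_continuation_def)
  with y' k show "k y \<in> gtilde ` (topspace Ytilde - topspace Y)" by auto
qed

theorem theorem2p6p2:
  fixes X Xhat :: "'a topology"
    and Y Yhat Ytilde :: "'b topology"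
    and Z Ztilde :: "'c topology"
    and f fhat :: "'a \<Rightarrow> 'b"
    and g gtilde :: "'b \<Rightarrow> 'c"
  assumes "continuous_map X Y f"
    and "continuous_map Y Z g"
    and "compact_continuation X Y f Xhat Yhat fhat"
    and "compact_continuation Y Z g Ytilde Ztilde gtilde"
  shows
    "((\<exists>j. compact_continuation Y Y id Yhat Ytilde j) \<or>
      (\<exists>j. compact_continuation Y Y id Ytilde Yhat j \<and>
           quotient_map Ytilde Yhat j \<and>
           (\<forall>y1 \<in> topspace Ytilde. \<forall>y2 \<in> topspace Ytilde.
              j y1 = j y2 \<longrightarrow> gtilde y1 = gtilde y2)) \<or>
      (\<exists>j. compact_continuation Y Y id Ytilde Yhat j \<and>
           j ` topspace Ytilde = topspace Yhat \<and> Hausdorff_space Yhat \<and>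
           (\<forall>y1 \<in> topspace Ytilde. \<forall>y2 \<in> topspace Ytilde.
              j y1 = j y2 \<longrightarrow> gtilde y1 = gtilde y2))
      \<longrightarrow> (\<exists>hhat. compact_continuation X Z (g \<circ> f) Xhat Ztilde hhat))
     \<and>
     (home_leaving_compact_continuation X Y f Xhat Yhat fhat \<and>
      ((\<exists>j. home_leaving_compact_continuation Y Y id Yhat Ytilde j) \<or>
       (\<exists>j. home_leaving_compact_continuation Y Y id Ytilde Yhat j \<and>
            quotient_map Ytilde Yhat j \<and>
            (\<forall>y1 \<in> topspace Ytilde. \<forall>y2 \<in> topspace Ytilde.
               j y1 = j y2 \<longrightarrow> gtilde y1 = gtilde y2)) \<or>
       (\<exists>j. home_leaving_compact_continuation Y Y id Ytilde Yhat j \<and>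
            j ` topspace Ytilde = topspace Yhat \<and> Hausdorff_space Yhat \<and>
            (\<forall>y1 \<in> topspace Ytilde. \<forall>y2 \<in> topspace Ytilde.
               j y1 = j y2 \<longrightarrow> gtilde y1 = gtilde y2)))
      \<longrightarrow> (\<exists>hhat. compact_continuation X Z (g \<circ> f) Xhat Ztilde hhat \<and>
             hhat ` (topspace Xhat - topspace X) \<subseteq> gtilde ` (topspace Ytilde - topspace Y)))"
proof -
  have Z: "contains_as_subspace Ztilde Z"
    using assms(4) by (simp add: compact_continuation_def)
  note compose = compact_continuation_compose[OF assms(3,2) Z]
  \<comment> \<open>\<open>fhat\<close> moves the points outside \<open>X\<close> to points outside
    \<open>Y\<close>, so only the values of \<open>k\<close> there matter.\<close>
  have home: "(k \<circ> fhat) ` (topspace Xhat - topspace X) \<subseteq> gtilde ` (topspace Ytilde - topspace Y)"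
    if "home_leaving_compact_continuation X Y f Xhat Yhat fhat"
      and "k ` (topspace Yhat - topspace Y) \<subseteq> gtilde ` (topspace Ytilde - topspace Y)" for k
    using that unfolding home_leaving_compact_continuation_def image_comp[symmetric] by blast
  let ?fibres = "\<lambda>j. \<forall>y1 \<in> topspace Ytilde. \<forall>y2 \<in> topspace Ytilde.
    j y1 = j y2 \<longrightarrow> gtilde y1 = gtilde y2"
  let ?concl = "\<exists>hhat. compact_continuation X Z (g \<circ> f) Xhat Ztilde hhat"
  let ?home_concl = "\<exists>hhat. compact_continuation X Z (g \<circ> f) Xhat Ztilde hhat \<and>
    hhat ` (topspace Xhat - topspace X) \<subseteq> gtilde ` (topspace Ytilde - topspace Y)"
  have along: ?concl if "compact_continuation Y Y id Yhat Ytilde j" for j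
    using compose[OF extension_along_id[OF assms(4) that]] by blast
  have through: ?concl
    if "compact_continuation Y Y id Ytilde Yhat j" "quotient_map Ytilde Yhat j" "?fibres j" for j
    using extension_through_quotient[OF assms(4) that] compose by metis
  have home_along: ?home_concl
    if f: "home_leaving_compact_continuation X Y f Xhat Yhat fhat"
      and j: "home_leaving_compact_continuation Y Y id Yhat Ytilde j" for j
    using compose[OF extension_along_id[OF assms(4) compact_continuation_if_home_leaving[OF j]]]
      home[OF f extension_image_along_id[OF j]] by blast
  have home_through: ?home_concl
    if f: "home_leaving_compact_continuation X Y f Xhat Yhat fhat"
      and j: "compact_continuation Y Y id Ytilde Yhat j" "quotient_map Ytilde Yhat j" "?fibres j" for j
  proof -
    obtain k where k: "continuous_map Yhat Ztilde k"
      "\<And>y. y \<in> topspace Ytilde \<Longrightarrow> k (j y) = gtilde y" "\<And>y. y \<in> topspace Y \<Longrightarrow> k y = g y"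
      using extension_through_quotient[OF assms(4) j] by blast
    have "k ` (topspace Yhat - topspace Y) \<subseteq> gtilde ` (topspace Ytilde - topspace Y)"
      by (rule extension_image_through_quotient[OF j(1) quotient_imp_surjective_map[OF j(2)]]) (rule k(2))
    from home[OF f this] compose[OF k(1,3)] show ?thesis by blast
  qed
  show ?thesis
  \<comment> \<open>Six goals arise, three conditions for each of the two claims. In those for
    (iii), \<open>quotient_map_onto_Hausdorff\<close> supplies the quotient map that
    \<open>through\<close> and \<open>home_through\<close> require.\<close>
  proof (intro conjI impI; elim conjE disjE exE)
  qed (blast intro: along through home_along home_through quotient_map_onto_Hausdorff
      compact_continuation_if_home_leaving)+
qed

end
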